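(* Let $A$ be a finite set of alternatives with $n$-point imprecise evaluations on criteria $g_1,\dots,g_m$, let $\mathcal U$ be the set of compatible value functions, and let $\Delta^S,\Delta,\Delta^W$ be the strong, normal and weak dominance relations, $\succsim^{SN},\succsim^N,\succsim^{WN}$ the strong, normal and weak necessary preference relations, and $\succsim^{SP},\succsim^P,\succsim^{WP}$ the strong, normal and weak possible preference relations on $A$. Then for all $a,b\in A$ the following implications hold: (horizontal) $a\Delta^S b\Rightarrow a\Delta b\Rightarrow a\Delta^W b$; $\ a\succsim^{SN}b\Rightarrow a\succsim^N b\Rightarrow a\succsim^{WN}b$; $\ a\succsim^{SP}b\Rightarrow a\succsim^P b\Rightarrow a\succsim^{WP}b$; (vertical) $a\Delta^S b\Rightarrow a\succsim^{SN}b\Rightarrow a\succsim^{SP}b$; $\ a\Delta b\Rightarrow a\succsim^N b\Rightarrow a\succsim^P b$; $\ a\Delta^W b\Rightarrow a\succsim^{WN}b\Rightarrow a\succsim^{WP}b$. Moreover, for all $a,b,c\in A$: 1. $a\succsim^{SN}b$ and $b\succsim^{N}c$ $\Rightarrow$ $a\succsim^{N}c$. 2. $a\succsim^{SN}b$ and $b\succsim^{P}c$ $\Rightarrow$ $a\succsim^{P}c$. 3. $a\succsim^{N}b$ and $b\succsim^{SN}c$ $\Rightarrow$ $a\succsim^{N}c$. 4. $a\succsim^{N}b$ and $b\succsim^{SP}c$ $\Rightarrow$ $a\succsim^{P}c$. 5. $a\succsim^{SP}b$ and $b\succsim^{N}c$ $\Rightarrow$ $a\succsim^{P}c$. 6.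 $a\succsim^{P}b$ and $b\succsim^{SN}c$ $\Rightarrow$ $a\succsim^{P}c$. 7. $a\succsim^{N}b$ or $b\succsim^{P}a$. 8. $a\succsim^{SN}b$ or $b\succsim^{WP}a$. 9. $a\succsim^{WN}b$ or $b\succsim^{SP}a$. 10. $a\Delta^{S}b$ and $b\Delta c$ $\Rightarrow$ $a\Delta^{S}c$. 11. $a\Delta^{S}b$ and $b\Delta^{W}c$ $\Rightarrow$ $a\Delta^{W}c$. 12. $a\Delta^{S}b$ and $b\succsim^{SN}c$ $\Rightarrow$ $a\succsim^{SN}c$. 13. $a\Delta^{S}b$ and $b\succsim^{N}c$ $\Rightarrow$ $a\succsim^{N}c$. 14. $a\Delta^{S}b$ and $b\succsim^{WN}c$ $\Rightarrow$ $a\succsim^{WN}c$. 15. $a\Delta^{S}b$ and $b\succsim^{SP}c$ $\Rightarrow$ $a\succsim^{SP}c$. 16. $a\Delta^{S}b$ and $b\succsim^{P}c$ $\Rightarrow$ $a\succsim^{P}c$. 17. $a\Delta^{S}b$ and $b\succsim^{WP}c$ $\Rightarrow$ $a\succsim^{WP}c$. 18. $a\Delta b$ and $b\Delta^{S}c$ $\Rightarrow$ $a\Delta^{S}c$. 19. $a\Delta b$ and $b\Delta^{W}c$ $\Rightarrow$ $a\Delta^{W}c$. 20. $a\Delta b$ and $b\succsim^{SN}c$ $\Rightarrow$ $a\succsim^{N}c$. 21. $a\Delta b$ and $b\succsim^{SP}c$ $\Rightarrow$ $a\succsim^{P}c$. 22. $a\Delta^{W}b$ and $b\Delta c$ $\Rightarrow$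 $a\Delta^{W}c$. 23. $a\Delta^{W}b$ and $b\succsim^{SN}c$ $\Rightarrow$ $a\succsim^{WN}c$. 24. $a\Delta^{W}b$ and $b\succsim^{SP}c$ $\Rightarrow$ $a\succsim^{WP}c$. 25. $a\succsim^{SN}b$ and $b\Delta^{S}c$ $\Rightarrow$ $a\succsim^{SN}c$. 26. $a\succsim^{SN}b$ and $b\Delta c$ $\Rightarrow$ $a\succsim^{N}c$. 27. $a\succsim^{SN}b$ and $b\Delta^{W}c$ $\Rightarrow$ $a\succsim^{WN}c$. 28. $a\succsim^{SN}b$ and $b\succsim^{WN}c$ $\Rightarrow$ $a\succsim^{WN}c$. 29. $a\succsim^{SN}b$ and $b\succsim^{SP}c$ $\Rightarrow$ $a\succsim^{SP}c$. 30. $a\succsim^{SN}b$ and $b\succsim^{WP}c$ $\Rightarrow$ $a\succsim^{WP}c$. 31. $a\succsim^{N}b$ and $b\Delta^{S}c$ $\Rightarrow$ $a\succsim^{N}c$. 32. $a\succsim^{WN}b$ and $b\Delta^{S}c$ $\Rightarrow$ $a\succsim^{WN}c$. 33. $a\succsim^{WN}b$ and $b\succsim^{SN}c$ $\Rightarrow$ $a\succsim^{WN}c$. 34. $a\succsim^{WN}b$ and $b\succsim^{SP}c$ $\Rightarrow$ $a\succsim^{WP}c$. 35. $a\succsim^{SP}b$ and $b\Delta^{S}c$ $\Rightarrow$ $a\succsim^{SP}c$. 36. $a\succsim^{SP}b$ and $b\Delta c$ $\Rightarrow$ $a\succsim^{P}c$. 37. $a\succsim^{SP}b$ and $b\Delta^{W}c$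 $\Rightarrow$ $a\succsim^{WP}c$. 38. $a\succsim^{SP}b$ and $b\succsim^{SN}c$ $\Rightarrow$ $a\succsim^{SP}c$. 39. $a\succsim^{SP}b$ and $b\succsim^{WN}c$ $\Rightarrow$ $a\succsim^{WP}c$. 40. $a\succsim^{P}b$ and $b\Delta^{S}c$ $\Rightarrow$ $a\succsim^{P}c$. 41. $a\succsim^{WP}b$ and $b\Delta^{S}c$ $\Rightarrow$ $a\succsim^{WP}c$. 42. $a\succsim^{WP}b$ and $b\succsim^{SN}c$ $\Rightarrow$ $a\succsim^{WP}c$.
   Context: Evaluations. $A$ is a finite set of alternatives, $J=\{1,\dots,m\}$ indexes the criteria, $n\ge1$ is an integer. Each criterion $g_j$, $j\in J$, assigns to each $a\in A$ an $n$-point evaluation $g_j(a)=[g_j^1(a),\dots,g_j^n(a)]$ of real numbers with $g_j^1(a)\le\dots\le g_j^n(a)$. Dominance. $a\Delta^{(i,k)}b$ iff $g_j^i(a)\ge g_j^k(b)$ for all $j\in J$; $a\Delta b$ (normal dominance) iff $g_j^i(a)\ge g_j^i(b)$ for all $j\in J$ and all $i\in\{1,\dots,n\}$. Strong dominance is $\Delta^S=\Delta^{(1,n)}$, weak dominance is $\Delta^W=\Delta^{(n,1)}$. Value functions. For $j\in J$, let $X_j(A)=\{g_j^i(a):a\in A,\ i=1,\dots,n\}=\{x_j^1<x_j^2<\dots<x_j^{m_j(A)}\}$. A value function $U$ is given by sub-marginal value functions $u_{j,i}:X_j(A)\to\mathbb R$ ($j\in J$, $i=1,\dots,n$), with $U_j(a)=\sum_{i=1}^n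 u_{j,i}(g_j^i(a))$ and $U(a)=\sum_{j=1}^m U_j(a)$. For $a\in A$ and $i\in\{1,\dots,n\}$, the fictitious alternative $a^{(i)}$ has all indicators on criterion $g_j$ equal to $g_j^i(a)$, so $U(a^{(i)})=\sum_{j=1}^m\sum_{r=1}^n u_{j,r}(g_j^i(a))$. Preference information. On a set $A^R\subseteq A$ of reference alternatives the decision maker provides partial preorders (reflexive, transitive relations) $\succsim$ and $\succsim_j$ ($j\in J$) on $A^R$, and $\succsim^*$ and $\succsim^*_j$ ($j\in J$) on $A^R\times A^R$; $\succ,\sim$ (with the same decorations) denote their asymmetric and symmetric parts. Compatibility. $U$ is compatible if: (i) for all $\bar a,\bar b,\bar c,\bar d\in A^R$ and $j\in J$: $U(\bar a)>U(\bar b)$ if $\bar a\succ\bar b$; $U(\bar a)=U(\bar b)$ if $\bar a\sim\bar b$; $U(\bar a)-U(\bar b)>U(\bar c)-U(\bar d)$ if $(\bar a,\bar b)\succ^*(\bar c,\bar d)$; $U(\bar a)-U(\bar b)=U(\bar c)-U(\bar d)$ if $(\bar a,\bar b)\sim^*(\bar c,\bar d)$; and the same four conditions with $U_j,\succ_j,\sim_j,\succ_j^*,\sim_j^*$ in place of $U,\succ,\sim,\succ^*,\sim^*$; (ii) $u_{j,i}(x_j^k)\ge u_{j,i}(x_j^{k-1})$ for all $j\in J$, $i=1,\dots,n$, $k=2,\dots,m_j(A)$; (iii) $u_{j,i}(x_j^1)=0$ for all $j,i$; (iv) $\sum_{j\in J}\sum_{i=1}^n u_{j,i}(x_j^{m_j(A)})=1$.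 $\mathcal U$ is the set of all compatible value functions; it is assumed to contain more than one element (in particular it is non-empty). Preference relations. For $a,b\in A$, $i,k\in\{1,\dots,n\}$: $a\succsim^N b$ iff $U(a)\ge U(b)$ for all $U\in\mathcal U$; $a\succsim^P b$ iff $U(a)\ge U(b)$ for some $U\in\mathcal U$; $a\succsim^N_{(i,k)}b$ iff $U(a^{(i)})\ge U(b^{(k)})$ for all $U\in\mathcal U$; $a\succsim^P_{(i,k)}b$ iff $U(a^{(i)})\ge U(b^{(k)})$ for some $U\in\mathcal U$. Notation: $\succsim^{SN}=\succsim^N_{(1,n)}$, $\succsim^{SP}=\succsim^P_{(1,n)}$, $\succsim^{WN}=\succsim^N_{(n,1)}$, $\succsim^{WP}=\succsim^P_{(n,1)}$. *)

theory Defs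
  imports Complex_Main "HOL-Library.FuncSet"
begin

text \<open>
  Criteria are indexed by \<open>{1..ncrit P}\<close> and the points of an evaluation by \<open>{1..npoints P}\<close>;
  \<open>crit P j a i\<close> is \<open>g\<^sub>j\<^sup>i(a)\<close>.  In the preference information, \<open>(a, b) \<in> pref P\<close> means
  that \<open>a\<close> is at least as good as \<open>b\<close>, and \<open>((a, b), (c, d)) \<in> intens P\<close> means that \<open>a\<close> is
  preferred to \<open>b\<close> at least as intensely as \<open>c\<close> is to \<open>d\<close>; the fields \<open>pref_crit\<close> and
  \<open>intens_crit\<close> are their versions for a single criterion.
\<close>

record 'a mcda =
  alts :: "'a set"
  ncrit :: nat
  npoints :: nat
  crit :: "nat \<Rightarrow> 'a \<Rightarrow> nat \<Rightarrow> real"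
  refs :: "'a set"
  pref :: "'a rel"
  pref_crit :: "nat \<Rightarrow> 'a rel"
  intens :: "('a \<times> 'a) rel"
  intens_crit :: "nat \<Rightarrow> ('a \<times> 'a) rel"

definition mcda_problem :: "'a mcda \<Rightarrow> bool" where
  "mcda_problem P \<longleftrightarrow>
     finite (alts P) \<and> npoints P \<ge> 1 \<and>
     (\<forall>j\<in>{1..ncrit P}. \<forall>a\<in>alts P. mono_on {1..npoints P} (crit P j a)) \<and>
     refs P \<subseteq> alts P \<and>
     preorder_on (refs P) (pref P) \<and>
     preorder_on (refs P \<times> refs P) (intens P) \<and>
     (\<forall>j\<in>{1..ncrit P}. preorder_on (refs P) (pref_crit P j) \<and>
        preorder_on (refs P \<times> refs P) (intens_crit P j))"


subsection \<open>Dominance\<close>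

definition dom_ik :: "'a mcda \<Rightarrow> nat \<Rightarrow> nat \<Rightarrow> 'a \<Rightarrow> 'a \<Rightarrow> bool" where
  "dom_ik P i k a b \<longleftrightarrow> (\<forall>j\<in>{1..ncrit P}. crit P j a i \<ge> crit P j b k)"

definition dom :: "'a mcda \<Rightarrow> 'a \<Rightarrow> 'a \<Rightarrow> bool"  (infix "\<Delta>\<index>" 50) where
  "a \<Delta>\<^bsub>P\<^esub> b \<longleftrightarrow> (\<forall>j\<in>{1..ncrit P}. \<forall>i\<in>{1..npoints P}. crit P j a i \<ge> crit P j b i)"

definition strong_dom :: "'a mcda \<Rightarrow> 'a \<Rightarrow> 'a \<Rightarrow> bool"  (infix "\<Delta>\<^sup>S\<index>" 50) where
  "a \<Delta>\<^sup>S\<^bsub>P\<^esub> b \<longleftrightarrow> dom_ik P 1 (npoints P) a b"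

definition weak_dom :: "'a mcda \<Rightarrow> 'a \<Rightarrow> 'a \<Rightarrow> bool"  (infix "\<Delta>\<^sup>W\<index>" 50) where
  "a \<Delta>\<^sup>W\<^bsub>P\<^esub> b \<longleftrightarrow> dom_ik P (npoints P) 1 a b"


subsection \<open>Value functions\<close>

definition crit_values :: "'a mcda \<Rightarrow> nat \<Rightarrow> real set" where
  "crit_values P j = {crit P j a i | a i. a \<in> alts P \<and> i \<in> {1..npoints P}}"

text \<open>\<open>level P j k\<close> is \<open>x\<^sub>j\<^sup>k\<close>, the \<open>k\<close>-th smallest element of \<open>X\<^sub>j(A)\<close>, for
  \<open>1 \<le> k \<le> nlevels P j\<close>.\<close>

definition nlevels :: "'a mcda \<Rightarrow> nat \<Rightarrow> nat" where
  "nlevels P j = card (crit_values P j)"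

definition level :: "'a mcda \<Rightarrow> nat \<Rightarrow> nat \<Rightarrow> real" where
  "level P j k = sorted_list_of_set (crit_values P j) ! (k - 1)"

text \<open>A value function is the family of its sub-marginal value functions \<open>u\<^sub>j\<^sub>,\<^sub>i\<close>, each defined
  on \<open>X\<^sub>j(A)\<close> only.  The extensional function spaces make two value functions equal as soon as
  they agree there, so that counting value functions is meaningful.\<close>

type_synonym submarginals = "nat \<Rightarrow> nat \<Rightarrow> real \<Rightarrow> real"

definition value_functions :: "'a mcda \<Rightarrow> submarginals set" where
  "value_functions P =
     (\<Pi>\<^sub>E j\<in>{1..ncrit P}. \<Pi>\<^sub>E i\<in>{1..npoints P}. crit_values P j \<rightarrow>\<^sub>E UNIV)"

text \<open>\<open>val\<close> and \<open>val_crit\<close> take the evaluations \<open>e j i\<close> of an alternative instead of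
  the alternative, so that they apply to real and to fictitious alternatives alike.\<close>

definition val_crit :: "'a mcda \<Rightarrow> submarginals \<Rightarrow> nat \<Rightarrow> (nat \<Rightarrow> nat \<Rightarrow> real) \<Rightarrow> real" where
  "val_crit P u j e = (\<Sum>i\<in>{1..npoints P}. u j i (e j i))"

definition val :: "'a mcda \<Rightarrow> submarginals \<Rightarrow> (nat \<Rightarrow> nat \<Rightarrow> real) \<Rightarrow> real" where
  "val P u e = (\<Sum>j\<in>{1..ncrit P}. val_crit P u j e)"

definition alt :: "'a mcda \<Rightarrow> 'a \<Rightarrow> nat \<Rightarrow> nat \<Rightarrow> real" where
  "alt P a = (\<lambda>j r. crit P j a r)"

definition fict :: "'a mcda \<Rightarrow> 'a \<Rightarrow> nat \<Rightarrow> nat \<Rightarrow> nat \<Rightarrow> real" where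
  "fict P a i = (\<lambda>j r. crit P j a i)"


subsection \<open>Compatibility\<close>

definition asym_part :: "'b rel \<Rightarrow> 'b rel" where
  "asym_part r = {(x, y). (x, y) \<in> r \<and> (y, x) \<notin> r}"

definition sym_part :: "'b rel \<Rightarrow> 'b rel" where
  "sym_part r = {(x, y). (x, y) \<in> r \<and> (y, x) \<in> r}"

definition represents :: "'a set \<Rightarrow> ('a \<Rightarrow> real) \<Rightarrow> 'a rel \<Rightarrow> ('a \<times> 'a) rel \<Rightarrow> bool" where
  "represents R V p q \<longleftrightarrow>
     (\<forall>a\<in>R. \<forall>b\<in>R. \<forall>c\<in>R. \<forall>d\<in>R.
        ((a, b) \<in> asym_part p \<longrightarrow> V a > V b) \<and>
        ((a, b) \<in> sym_part p \<longrightarrow> V a = V b) \<and>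
        (((a, b), (c, d)) \<in> asym_part q \<longrightarrow> V a - V b > V c - V d) \<and>
        (((a, b), (c, d)) \<in> sym_part q \<longrightarrow> V a - V b = V c - V d))"

definition compatible :: "'a mcda \<Rightarrow> submarginals \<Rightarrow> bool" where
  "compatible P u \<longleftrightarrow>
     represents (refs P) (\<lambda>a. val P u (alt P a)) (pref P) (intens P) \<and>
     (\<forall>j\<in>{1..ncrit P}.
        represents (refs P) (\<lambda>a. val_crit P u j (alt P a)) (pref_crit P j) (intens_crit P j)) \<and>
     (\<forall>j\<in>{1..ncrit P}. \<forall>i\<in>{1..npoints P}. \<forall>k\<in>{2..nlevels P j}.
        u j i (level P j k) \<ge> u j i (level P j (k - 1))) \<and>
     (\<forall>j\<in>{1..ncrit P}. \<forall>i\<in>{1..npoints P}. u j i (level P j 1) = 0) \<and>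
     (\<Sum>j\<in>{1..ncrit P}. \<Sum>i\<in>{1..npoints P}. u j i (level P j (nlevels P j))) = 1"

definition compatibles :: "'a mcda \<Rightarrow> submarginals set"  ("\<U>\<index>") where
  "\<U>\<^bsub>P\<^esub> = {u \<in> value_functions P. compatible P u}"


subsection \<open>Necessary and possible preference\<close>

definition nec :: "'a mcda \<Rightarrow> 'a \<Rightarrow> 'a \<Rightarrow> bool"  (infix "\<succsim>\<^sup>N\<index>" 50) where
  "a \<succsim>\<^sup>N\<^bsub>P\<^esub> b \<longleftrightarrow> (\<forall>u\<in>\<U>\<^bsub>P\<^esub>. val P u (alt P a) \<ge> val P u (alt P b))"

definition pos :: "'a mcda \<Rightarrow> 'a \<Rightarrow> 'a \<Rightarrow> bool"  (infix "\<succsim>\<^sup>P\<index>" 50) where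
  "a \<succsim>\<^sup>P\<^bsub>P\<^esub> b \<longleftrightarrow> (\<exists>u\<in>\<U>\<^bsub>P\<^esub>. val P u (alt P a) \<ge> val P u (alt P b))"

definition nec_ik :: "'a mcda \<Rightarrow> nat \<Rightarrow> nat \<Rightarrow> 'a \<Rightarrow> 'a \<Rightarrow> bool" where
  "nec_ik P i k a b \<longleftrightarrow> (\<forall>u\<in>\<U>\<^bsub>P\<^esub>. val P u (fict P a i) \<ge> val P u (fict P b k))"

definition pos_ik :: "'a mcda \<Rightarrow> nat \<Rightarrow> nat \<Rightarrow> 'a \<Rightarrow> 'a \<Rightarrow> bool" where
  "pos_ik P i k a b \<longleftrightarrow> (\<exists>u\<in>\<U>\<^bsub>P\<^esub>. val P u (fict P a i) \<ge> val P u (fict P b k))"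

definition strong_nec :: "'a mcda \<Rightarrow> 'a \<Rightarrow> 'a \<Rightarrow> bool"  (infix "\<succsim>\<^sup>S\<^sup>N\<index>" 50) where
  "a \<succsim>\<^sup>S\<^sup>N\<^bsub>P\<^esub> b \<longleftrightarrow> nec_ik P 1 (npoints P) a b"

definition strong_pos :: "'a mcda \<Rightarrow> 'a \<Rightarrow> 'a \<Rightarrow> bool"  (infix "\<succsim>\<^sup>S\<^sup>P\<index>" 50) where
  "a \<succsim>\<^sup>S\<^sup>P\<^bsub>P\<^esub> b \<longleftrightarrow> pos_ik P 1 (npoints P) a b"

definition weak_nec :: "'a mcda \<Rightarrow> 'a \<Rightarrow> 'a \<Rightarrow> bool"  (infix "\<succsim>\<^sup>W\<^sup>N\<index>" 50) where
  "a \<succsim>\<^sup>W\<^sup>N\<^bsub>P\<^esub> b \<longleftrightarrow> nec_ik P (npoints P) 1 a b"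

definition weak_pos :: "'a mcda \<Rightarrow> 'a \<Rightarrow> 'a \<Rightarrow> bool"  (infix "\<succsim>\<^sup>W\<^sup>P\<index>" 50) where
  "a \<succsim>\<^sup>W\<^sup>P\<^bsub>P\<^esub> b \<longleftrightarrow> pos_ik P (npoints P) 1 a b"

end

theory Submission
  imports Defs
begin

text \<open>
  Fix a compatible value function \<open>U\<close>.  Compatibility makes every submarginal \<open>u\<^sub>j\<^sub>,\<^sub>i\<close>
  nondecreasing on all of \<open>X\<^sub>j(A)\<close>, so \<open>U\<close> is monotone in the evaluations.  Hence each
  alternative \<open>a\<close> determines an interval \<open>[U(a\<^sup>(\<^sup>1\<^sup>)), U(a\<^sup>(\<^sup>n\<^sup>))]\<close> that contains the point \<open>U(a)\<close>,
  and \<open>U\<close> compares two alternatives in three ways: strongly (the lower end of one interval against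
  the upper end of the other), normally (point against point) and weakly (upper end against lower
  end).

  The statements about preference rest on three observations under a single \<open>U\<close>.  The strong
  comparison implies the normal one, which implies the weak one.  Composing any of the three with a
  strong comparison, on either side, preserves it (\<open>strong_comp_normal\<close> and its
  companions).  Dominance of each kind implies the comparison of the same kind
  (\<open>dominance_compares\<close>), by monotonicity.

  A necessary preference is a comparison under all \<open>U\<close> and a possible preference one under some \<open>U\<close>.
  The composition rules therefore lift: necessary with necessary gives necessary, and necessary with
  possible, in either order, gives possible (\<open>preference_compositions\<close>).  Necessary implies
  possible because some compatible value function exists.  If a necessary preference fails, then some
  \<open>U\<close> violates it, and that \<open>U\<close> witnesses the reverse possible preference, with strong and
  weak interchanged (\<open>necessary_or_possible_converse\<close>).  Statements about dominance alone follow
  by the same reasoning applied to the evaluations, criterion by criterion.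
\<close>

section \<open>Monotonicity of compatible value functions\<close>

lemma finite_crit_values:
  assumes "finite (alts P)"
  shows "finite (crit_values P j)"
proof -
  have "crit_values P j = (\<lambda>(a, i). crit P j a i) ` (alts P \<times> {1..npoints P})"
    unfolding crit_values_def by force
  then show ?thesis using assms by simp
qed

lemma crit_values_eq_levels:
  assumes "finite (alts P)"
  shows "crit_values P j = level P j ` {1..nlevels P j}"
proof -
  let ?xs = "sorted_list_of_set (crit_values P j)"
  have len: "length ?xs = nlevels P j"
    by (simp add: nlevels_def)
  have "crit_values P j = set ?xs"
    using finite_crit_values[OF assms] by simp
  also have "\<dots> = (\<lambda>k. ?xs ! (k - 1)) ` Suc ` {0..<nlevels P j}"
    unfolding set_conv_nth len image_image by auto
  also have "\<dots> = level P j ` {1..nlevels P j}"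
    by (simp add: level_def image_Suc_atLeastLessThan atLeastLessThanSuc_atLeastAtMost)
  finally show ?thesis .
qed

lemma level_strict_mono:
  assumes "1 \<le> k" "k < l" "l \<le> nlevels P j"
  shows "level P j k < level P j l"
  unfolding level_def
  by (rule sorted_wrt_nth_less[OF strict_sorted_list_of_set])
     (use assms in \<open>simp_all add: nlevels_def\<close>)

text \<open>Compatibility compares consecutive levels only; since the levels exhaust \<open>X\<^sub>j(A)\<close>,
  induction along them extends the comparison to arbitrary attained values.\<close>

lemma submarginal_mono:
  assumes fin: "finite (alts P)" and u: "compatible P u"
    and j: "j \<in> {1..ncrit P}" and i: "i \<in> {1..npoints P}"
    and x: "x \<in> crit_values P j" and y: "y \<in> crit_values P j" and "x \<le> y"
  shows "u j i x \<le> u j i y"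
proof -
  obtain k where k: "1 \<le> k" "k \<le> nlevels P j" "x = level P j k"
    using x unfolding crit_values_eq_levels[OF fin] by auto
  obtain l where l: "1 \<le> l" "l \<le> nlevels P j" "y = level P j l"
    using y unfolding crit_values_eq_levels[OF fin] by auto
  have "k \<le> l"
    using level_strict_mono[of l k P j] k l \<open>x \<le> y\<close> by (meson leD le_less_linear)
  then have "l \<le> nlevels P j \<longrightarrow> u j i (level P j k) \<le> u j i (level P j l)"
  proof (induction l rule: dec_induct)
    case base
    show ?case by simp
  next
    case (step m)
    show ?case
    proof
      assume m: "Suc m \<le> nlevels P j"
      have "Suc m \<in> {2..nlevels P j}"
        using m step.hyps k(1) by simp
      then have "u j i (level P j (Suc m - 1)) \<le> u j i (level P j (Suc m))"
        using u i j unfolding compatible_def by blast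
      then show "u j i (level P j k) \<le> u j i (level P j (Suc m))"
        using step.IH m by simp
    qed
  qed
  then show ?thesis using k l by simp
qed

lemma val_mono:
  assumes "finite (alts P)" "compatible P u"
    and "\<And>j i. j \<in> {1..ncrit P} \<Longrightarrow> i \<in> {1..npoints P} \<Longrightarrow>
           e j i \<in> crit_values P j \<and> f j i \<in> crit_values P j \<and> e j i \<le> f j i"
  shows "val P u e \<le> val P u f"
  unfolding val_def val_crit_def
  using assms(3) by (intro sum_mono submarginal_mono[OF assms(1,2)]) blast+

lemma crit_in_crit_values:
  "a \<in> alts P \<Longrightarrow> i \<in> {1..npoints P} \<Longrightarrow> crit P j a i \<in> crit_values P j"
  unfolding crit_values_def by blast

lemma crit_mono:
  assumes "mcda_problem P" "a \<in> alts P" "j \<in> {1..ncrit P}"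
    and "i \<in> {1..npoints P}" "k \<in> {1..npoints P}" "i \<le> k"
  shows "crit P j a i \<le> crit P j a k"
  using assms unfolding mcda_problem_def mono_on_def by blast

lemma mcda_problemD:
  assumes "mcda_problem P"
  shows "finite (alts P)" "1 \<in> {1..npoints P}" "npoints P \<in> {1..npoints P}"
  using assms unfolding mcda_problem_def by auto


section \<open>Comparisons under a single value function\<close>

definition strong_at :: "'a mcda \<Rightarrow> submarginals \<Rightarrow> 'a \<Rightarrow> 'a \<Rightarrow> bool" where
  "strong_at P u a b \<longleftrightarrow> val P u (fict P a 1) \<ge> val P u (fict P b (npoints P))"

definition normal_at :: "'a mcda \<Rightarrow> submarginals \<Rightarrow> 'a \<Rightarrow> 'a \<Rightarrow> bool" where
  "normal_at P u a b \<longleftrightarrow> val P u (alt P a) \<ge> val P u (alt P b)"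

definition weak_at :: "'a mcda \<Rightarrow> submarginals \<Rightarrow> 'a \<Rightarrow> 'a \<Rightarrow> bool" where
  "weak_at P u a b \<longleftrightarrow> val P u (fict P a (npoints P)) \<ge> val P u (fict P b 1)"

lemmas at_defs = strong_at_def normal_at_def weak_at_def

lemma preference_iff_at:
  "a \<succsim>\<^sup>S\<^sup>N\<^bsub>P\<^esub> b \<longleftrightarrow> (\<forall>u\<in>\<U>\<^bsub>P\<^esub>. strong_at P u a b)"
  "a \<succsim>\<^sup>N\<^bsub>P\<^esub> b \<longleftrightarrow> (\<forall>u\<in>\<U>\<^bsub>P\<^esub>. normal_at P u a b)"
  "a \<succsim>\<^sup>W\<^sup>N\<^bsub>P\<^esub> b \<longleftrightarrow> (\<forall>u\<in>\<U>\<^bsub>P\<^esub>. weak_at P u a b)"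
  "a \<succsim>\<^sup>S\<^sup>P\<^bsub>P\<^esub> b \<longleftrightarrow> (\<exists>u\<in>\<U>\<^bsub>P\<^esub>. strong_at P u a b)"
  "a \<succsim>\<^sup>P\<^bsub>P\<^esub> b \<longleftrightarrow> (\<exists>u\<in>\<U>\<^bsub>P\<^esub>. normal_at P u a b)"
  "a \<succsim>\<^sup>W\<^sup>P\<^bsub>P\<^esub> b \<longleftrightarrow> (\<exists>u\<in>\<U>\<^bsub>P\<^esub>. weak_at P u a b)"
  by (simp_all add: at_defs strong_nec_def nec_def weak_nec_def strong_pos_def pos_def weak_pos_def
      nec_ik_def pos_ik_def)

text \<open>The points of an evaluation are nondecreasing, so the fictitious alternative of the first
  points lies below \<open>a\<close> in every indicator and that of the last points above.  This places
  \<open>U(a)\<close> in the interval spanned by their values.\<close>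

lemma val_between_extremes:
  assumes P: "mcda_problem P" and u: "u \<in> \<U>\<^bsub>P\<^esub>" and a: "a \<in> alts P"
  shows "val P u (fict P a 1) \<le> val P u (alt P a)"
    and "val P u (alt P a) \<le> val P u (fict P a (npoints P))"
proof -
  have c: "compatible P u" using u by (simp add: compatibles_def)
  note fin = mcda_problemD[OF P]
  show "val P u (fict P a 1) \<le> val P u (alt P a)"
    unfolding fict_def alt_def
    using fin a by (intro val_mono[OF fin(1) c]) (auto intro: crit_in_crit_values crit_mono[OF P])
  show "val P u (alt P a) \<le> val P u (fict P a (npoints P))"
    unfolding fict_def alt_def
    using fin a by (intro val_mono[OF fin(1) c]) (auto intro: crit_in_crit_values crit_mono[OF P])
qed

context
  fixes P :: "'a mcda" and u a b
  assumes P: "mcda_problem P" and u: "u \<in> \<U>\<^bsub>P\<^esub>" and a: "a \<in> alts P" and b: "b \<in> alts P"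
begin

lemma strong_imp_normal: "strong_at P u a b \<Longrightarrow> normal_at P u a b"
  using val_between_extremes[OF P u a] val_between_extremes[OF P u b] unfolding at_defs by linarith

lemma normal_imp_weak: "normal_at P u a b \<Longrightarrow> weak_at P u a b"
  using val_between_extremes[OF P u a] val_between_extremes[OF P u b] unfolding at_defs by linarith

text \<open>A normal comparison followed by a weak one yields nothing in general: overlap of two intervals
  says nothing about the points inside them.  A strong comparison separates the intervals
  completely, and therefore composes with every kind of comparison.\<close>

lemma strong_comp_strong: "strong_at P u a b \<Longrightarrow> strong_at P u b c \<Longrightarrow> strong_at P u a c"
  using val_between_extremes[OF P u b] unfolding at_defs by linarith

lemma strong_comp_normal: "strong_at P u a b \<Longrightarrow> normal_at P u b c \<Longrightarrow> normal_at P u a c"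
  using strong_imp_normal unfolding normal_at_def by fastforce

lemma strong_comp_weak: "strong_at P u a b \<Longrightarrow> weak_at P u b c \<Longrightarrow> weak_at P u a c"
  using val_between_extremes[OF P u a] unfolding at_defs by linarith

lemma normal_comp_strong: "normal_at P u c a \<Longrightarrow> strong_at P u a b \<Longrightarrow> normal_at P u c b"
  using strong_imp_normal unfolding normal_at_def by fastforce

lemma weak_comp_strong: "weak_at P u c a \<Longrightarrow> strong_at P u a b \<Longrightarrow> weak_at P u c b"
  using val_between_extremes[OF P u b] unfolding at_defs by linarith

lemma dominance_compares:
  shows "a \<Delta>\<^sup>S\<^bsub>P\<^esub> b \<Longrightarrow> strong_at P u a b"
    and "a \<Delta>\<^bsub>P\<^esub> b \<Longrightarrow> normal_at P u a b"
    and "a \<Delta>\<^sup>W\<^bsub>P\<^esub> b \<Longrightarrow> weak_at P u a b"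
proof -
  have c: "compatible P u" using u by (simp add: compatibles_def)
  note fin = mcda_problemD[OF P]
  note [intro] = val_mono[OF fin(1) c]
  note [simp] = at_defs strong_dom_def dom_def weak_dom_def dom_ik_def fict_def alt_def
    crit_in_crit_values
  show "a \<Delta>\<^sup>S\<^bsub>P\<^esub> b \<Longrightarrow> strong_at P u a b" using fin a b by auto
  show "a \<Delta>\<^bsub>P\<^esub> b \<Longrightarrow> normal_at P u a b" using fin a b by auto
  show "a \<Delta>\<^sup>W\<^bsub>P\<^esub> b \<Longrightarrow> weak_at P u a b" using fin a b by auto
qed

end


section \<open>Composition of dominance relations\<close>

context
  fixes P :: "'a mcda" and a b
  assumes P: "mcda_problem P" and a: "a \<in> alts P" and b: "b \<in> alts P"
begin

lemma strong_dom_imp_dom: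
  assumes "a \<Delta>\<^sup>S\<^bsub>P\<^esub> b"
  shows "a \<Delta>\<^bsub>P\<^esub> b"
  unfolding dom_def
proof (intro ballI)
  fix j i assume j: "j \<in> {1..ncrit P}" and i: "i \<in> {1..npoints P}"
  note n = mcda_problemD[OF P]
  have "crit P j b i \<le> crit P j b (npoints P)"
    using crit_mono[OF P b j i n(3)] i by simp
  also have "\<dots> \<le> crit P j a 1"
    using assms j by (simp add: strong_dom_def dom_ik_def)
  also have "\<dots> \<le> crit P j a i"
    using crit_mono[OF P a j n(2) i] i by simp
  finally show "crit P j b i \<le> crit P j a i" .
qed

lemma dom_imp_weak_dom:
  assumes "a \<Delta>\<^bsub>P\<^esub> b"
  shows "a \<Delta>\<^sup>W\<^bsub>P\<^esub> b"
  unfolding weak_dom_def dom_ik_def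
proof
  fix j assume j: "j \<in> {1..ncrit P}"
  note n = mcda_problemD[OF P]
  have "crit P j b 1 \<le> crit P j a 1"
    using assms j n by (simp add: dom_def)
  also have "\<dots> \<le> crit P j a (npoints P)"
    using crit_mono[OF P a j n(2,3)] n by simp
  finally show "crit P j b 1 \<le> crit P j a (npoints P)" .
qed

end

text \<open>Unlike the normal comparison under \<open>U\<close>, normal dominance also bounds the first and the last points
  of the evaluations, and so composes with strong and weak dominance.\<close>

lemma dom_compositions:
  assumes "mcda_problem P"
  shows "a \<Delta>\<^sup>S\<^bsub>P\<^esub> b \<Longrightarrow> b \<Delta>\<^bsub>P\<^esub> c \<Longrightarrow> a \<Delta>\<^sup>S\<^bsub>P\<^esub> c"
    and "a \<Delta>\<^bsub>P\<^esub> b \<Longrightarrow> b \<Delta>\<^sup>S\<^bsub>P\<^esub> c \<Longrightarrow> a \<Delta>\<^sup>S\<^bsub>P\<^esub> c"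
    and "a \<Delta>\<^bsub>P\<^esub> b \<Longrightarrow> b \<Delta>\<^sup>W\<^bsub>P\<^esub> c \<Longrightarrow> a \<Delta>\<^sup>W\<^bsub>P\<^esub> c"
    and "a \<Delta>\<^sup>W\<^bsub>P\<^esub> b \<Longrightarrow> b \<Delta>\<^bsub>P\<^esub> c \<Longrightarrow> a \<Delta>\<^sup>W\<^bsub>P\<^esub> c"
  using mcda_problemD[OF assms] unfolding strong_dom_def weak_dom_def dom_def dom_ik_def
  by (meson order_trans)+


section \<open>Necessary and possible preference\<close>

lemma necessary_or_possible_converse:
  fixes P (structure)
  shows "a \<succsim>\<^sup>N b \<or> b \<succsim>\<^sup>P a" "a \<succsim>\<^sup>S\<^sup>N b \<or> b \<succsim>\<^sup>W\<^sup>P a" "a \<succsim>\<^sup>W\<^sup>N b \<or> b \<succsim>\<^sup>S\<^sup>P a"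
  unfolding preference_iff_at at_defs by (meson linear)+

context
  fixes P :: "'a mcda" (structure)
  assumes P: "mcda_problem P"
begin

lemma hierarchy:
  assumes ne: "\<U> \<noteq> {}" and ab: "a \<in> alts P" "b \<in> alts P"
  shows "a \<Delta>\<^sup>S b \<longrightarrow> a \<Delta> b" "a \<Delta> b \<longrightarrow> a \<Delta>\<^sup>W b"
    and "a \<succsim>\<^sup>S\<^sup>N b \<longrightarrow> a \<succsim>\<^sup>N b" "a \<succsim>\<^sup>N b \<longrightarrow> a \<succsim>\<^sup>W\<^sup>N b"
    and "a \<succsim>\<^sup>S\<^sup>P b \<longrightarrow> a \<succsim>\<^sup>P b" "a \<succsim>\<^sup>P b \<longrightarrow> a \<succsim>\<^sup>W\<^sup>P b"
    and "a \<Delta>\<^sup>S b \<longrightarrow> a \<succsim>\<^sup>S\<^sup>N b" "a \<Delta> b \<longrightarrow> a \<succsim>\<^sup>N b" "a \<Delta>\<^sup>W b \<longrightarrow> a \<succsim>\<^sup>W\<^sup>N b"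
    and "a \<succsim>\<^sup>S\<^sup>N b \<longrightarrow> a \<succsim>\<^sup>S\<^sup>P b" "a \<succsim>\<^sup>N b \<longrightarrow> a \<succsim>\<^sup>P b" "a \<succsim>\<^sup>W\<^sup>N b \<longrightarrow> a \<succsim>\<^sup>W\<^sup>P b"
  unfolding preference_iff_at
  using strong_dom_imp_dom[OF P ab] dom_imp_weak_dom[OF P ab]
    strong_imp_normal[OF P _ ab] normal_imp_weak[OF P _ ab]
    dominance_compares[OF P _ ab] ne
  by blast+

text \<open>Each composition rule under a single \<open>U\<close> yields three rules here, since a possible preference and
  a necessary one are witnessed by a common \<open>U\<close>.  Two possible preferences may have different witnesses, so
  they need not compose.\<close>

lemma preference_compositions:
  assumes a: "a \<in> alts P" and b: "b \<in> alts P" and c: "c \<in> alts P"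
  shows "a \<succsim>\<^sup>S\<^sup>N b \<and> b \<succsim>\<^sup>S\<^sup>N c \<longrightarrow> a \<succsim>\<^sup>S\<^sup>N c"
      "a \<succsim>\<^sup>S\<^sup>N b \<and> b \<succsim>\<^sup>S\<^sup>P c \<longrightarrow> a \<succsim>\<^sup>S\<^sup>P c"
      "a \<succsim>\<^sup>S\<^sup>P b \<and> b \<succsim>\<^sup>S\<^sup>N c \<longrightarrow> a \<succsim>\<^sup>S\<^sup>P c"
    and "a \<succsim>\<^sup>S\<^sup>N b \<and> b \<succsim>\<^sup>N c \<longrightarrow> a \<succsim>\<^sup>N c"
      "a \<succsim>\<^sup>S\<^sup>N b \<and> b \<succsim>\<^sup>P c \<longrightarrow> a \<succsim>\<^sup>P c"
      "a \<succsim>\<^sup>S\<^sup>P b \<and> b \<succsim>\<^sup>N c \<longrightarrow> a \<succsim>\<^sup>P c"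
    and "a \<succsim>\<^sup>S\<^sup>N b \<and> b \<succsim>\<^sup>W\<^sup>N c \<longrightarrow> a \<succsim>\<^sup>W\<^sup>N c"
      "a \<succsim>\<^sup>S\<^sup>N b \<and> b \<succsim>\<^sup>W\<^sup>P c \<longrightarrow> a \<succsim>\<^sup>W\<^sup>P c"
      "a \<succsim>\<^sup>S\<^sup>P b \<and> b \<succsim>\<^sup>W\<^sup>N c \<longrightarrow> a \<succsim>\<^sup>W\<^sup>P c"
    and "a \<succsim>\<^sup>N b \<and> b \<succsim>\<^sup>S\<^sup>N c \<longrightarrow> a \<succsim>\<^sup>N c"
      "a \<succsim>\<^sup>N b \<and> b \<succsim>\<^sup>S\<^sup>P c \<longrightarrow> a \<succsim>\<^sup>P c"
      "a \<succsim>\<^sup>P b \<and> b \<succsim>\<^sup>S\<^sup>N c \<longrightarrow> a \<succsim>\<^sup>P c"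
    and "a \<succsim>\<^sup>W\<^sup>N b \<and> b \<succsim>\<^sup>S\<^sup>N c \<longrightarrow> a \<succsim>\<^sup>W\<^sup>N c"
      "a \<succsim>\<^sup>W\<^sup>N b \<and> b \<succsim>\<^sup>S\<^sup>P c \<longrightarrow> a \<succsim>\<^sup>W\<^sup>P c"
      "a \<succsim>\<^sup>W\<^sup>P b \<and> b \<succsim>\<^sup>S\<^sup>N c \<longrightarrow> a \<succsim>\<^sup>W\<^sup>P c"
  unfolding preference_iff_at
  using strong_comp_strong[OF P _ a b, of _ c] strong_comp_normal[OF P _ a b, of _ c]
    strong_comp_weak[OF P _ a b, of _ c] normal_comp_strong[OF P _ b c, of _ a]
    weak_comp_strong[OF P _ b c, of _ a]
  by blast+

end

theorem proposition4p2:
  fixes P :: "'a mcda" (structure)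
  assumes "mcda_problem P"
    and "\<exists>u\<in>\<U>. \<exists>v\<in>\<U>. u \<noteq> v"
  shows
    "(\<forall>a\<in>alts P. \<forall>b\<in>alts P.
       (a \<Delta>\<^sup>S b \<longrightarrow> a \<Delta> b) \<and> (a \<Delta> b \<longrightarrow> a \<Delta>\<^sup>W b) \<and>
       (a \<succsim>\<^sup>S\<^sup>N b \<longrightarrow> a \<succsim>\<^sup>N b) \<and> (a \<succsim>\<^sup>N b \<longrightarrow> a \<succsim>\<^sup>W\<^sup>N b) \<and>
       (a \<succsim>\<^sup>S\<^sup>P b \<longrightarrow> a \<succsim>\<^sup>P b) \<and> (a \<succsim>\<^sup>P b \<longrightarrow> a \<succsim>\<^sup>W\<^sup>P b) \<and>
       (a \<Delta>\<^sup>S b \<longrightarrow> a \<succsim>\<^sup>S\<^sup>N b) \<and> (a \<succsim>\<^sup>S\<^sup>N b \<longrightarrow> a \<succsim>\<^sup>S\<^sup>P b) \<and>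
       (a \<Delta> b \<longrightarrow> a \<succsim>\<^sup>N b) \<and> (a \<succsim>\<^sup>N b \<longrightarrow> a \<succsim>\<^sup>P b) \<and>
       (a \<Delta>\<^sup>W b \<longrightarrow> a \<succsim>\<^sup>W\<^sup>N b) \<and> (a \<succsim>\<^sup>W\<^sup>N b \<longrightarrow> a \<succsim>\<^sup>W\<^sup>P b)) \<and>
     (\<forall>a\<in>alts P. \<forall>b\<in>alts P. \<forall>c\<in>alts P.
       (a \<succsim>\<^sup>S\<^sup>N b \<and> b \<succsim>\<^sup>N c \<longrightarrow> a \<succsim>\<^sup>N c) \<and>
       (a \<succsim>\<^sup>S\<^sup>N b \<and> b \<succsim>\<^sup>P c \<longrightarrow> a \<succsim>\<^sup>P c) \<and>
       (a \<succsim>\<^sup>N b \<and> b \<succsim>\<^sup>S\<^sup>N c \<longrightarrow> a \<succsim>\<^sup>N c) \<and>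
       (a \<succsim>\<^sup>N b \<and> b \<succsim>\<^sup>S\<^sup>P c \<longrightarrow> a \<succsim>\<^sup>P c) \<and>
       (a \<succsim>\<^sup>S\<^sup>P b \<and> b \<succsim>\<^sup>N c \<longrightarrow> a \<succsim>\<^sup>P c) \<and>
       (a \<succsim>\<^sup>P b \<and> b \<succsim>\<^sup>S\<^sup>N c \<longrightarrow> a \<succsim>\<^sup>P c) \<and>
       (a \<succsim>\<^sup>N b \<or> b \<succsim>\<^sup>P a) \<and>
       (a \<succsim>\<^sup>S\<^sup>N b \<or> b \<succsim>\<^sup>W\<^sup>P a) \<and>
       (a \<succsim>\<^sup>W\<^sup>N b \<or> b \<succsim>\<^sup>S\<^sup>P a) \<and>
       (a \<Delta>\<^sup>S b \<and> b \<Delta> c \<longrightarrow> a \<Delta>\<^sup>S c) \<and>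
       (a \<Delta>\<^sup>S b \<and> b \<Delta>\<^sup>W c \<longrightarrow> a \<Delta>\<^sup>W c) \<and>
       (a \<Delta>\<^sup>S b \<and> b \<succsim>\<^sup>S\<^sup>N c \<longrightarrow> a \<succsim>\<^sup>S\<^sup>N c) \<and>
       (a \<Delta>\<^sup>S b \<and> b \<succsim>\<^sup>N c \<longrightarrow> a \<succsim>\<^sup>N c) \<and>
       (a \<Delta>\<^sup>S b \<and> b \<succsim>\<^sup>W\<^sup>N c \<longrightarrow> a \<succsim>\<^sup>W\<^sup>N c) \<and>
       (a \<Delta>\<^sup>S b \<and> b \<succsim>\<^sup>S\<^sup>P c \<longrightarrow> a \<succsim>\<^sup>S\<^sup>P c) \<and>
       (a \<Delta>\<^sup>S b \<and> b \<succsim>\<^sup>P c \<longrightarrow> a \<succsim>\<^sup>P c) \<and>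
       (a \<Delta>\<^sup>S b \<and> b \<succsim>\<^sup>W\<^sup>P c \<longrightarrow> a \<succsim>\<^sup>W\<^sup>P c) \<and>
       (a \<Delta> b \<and> b \<Delta>\<^sup>S c \<longrightarrow> a \<Delta>\<^sup>S c) \<and>
       (a \<Delta> b \<and> b \<Delta>\<^sup>W c \<longrightarrow> a \<Delta>\<^sup>W c) \<and>
       (a \<Delta> b \<and> b \<succsim>\<^sup>S\<^sup>N c \<longrightarrow> a \<succsim>\<^sup>N c) \<and>
       (a \<Delta> b \<and> b \<succsim>\<^sup>S\<^sup>P c \<longrightarrow> a \<succsim>\<^sup>P c) \<and>
       (a \<Delta>\<^sup>W b \<and> b \<Delta> c \<longrightarrow> a \<Delta>\<^sup>W c) \<and>
       (a \<Delta>\<^sup>W b \<and> b \<succsim>\<^sup>S\<^sup>N c \<longrightarrow> a \<succsim>\<^sup>W\<^sup>N c) \<and>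
       (a \<Delta>\<^sup>W b \<and> b \<succsim>\<^sup>S\<^sup>P c \<longrightarrow> a \<succsim>\<^sup>W\<^sup>P c) \<and>
       (a \<succsim>\<^sup>S\<^sup>N b \<and> b \<Delta>\<^sup>S c \<longrightarrow> a \<succsim>\<^sup>S\<^sup>N c) \<and>
       (a \<succsim>\<^sup>S\<^sup>N b \<and> b \<Delta> c \<longrightarrow> a \<succsim>\<^sup>N c) \<and>
       (a \<succsim>\<^sup>S\<^sup>N b \<and> b \<Delta>\<^sup>W c \<longrightarrow> a \<succsim>\<^sup>W\<^sup>N c) \<and>
       (a \<succsim>\<^sup>S\<^sup>N b \<and> b \<succsim>\<^sup>W\<^sup>N c \<longrightarrow> a \<succsim>\<^sup>W\<^sup>N c) \<and>
       (a \<succsim>\<^sup>S\<^sup>N b \<and> b \<succsim>\<^sup>S\<^sup>P c \<longrightarrow> a \<succsim>\<^sup>S\<^sup>P c) \<and>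
       (a \<succsim>\<^sup>S\<^sup>N b \<and> b \<succsim>\<^sup>W\<^sup>P c \<longrightarrow> a \<succsim>\<^sup>W\<^sup>P c) \<and>
       (a \<succsim>\<^sup>N b \<and> b \<Delta>\<^sup>S c \<longrightarrow> a \<succsim>\<^sup>N c) \<and>
       (a \<succsim>\<^sup>W\<^sup>N b \<and> b \<Delta>\<^sup>S c \<longrightarrow> a \<succsim>\<^sup>W\<^sup>N c) \<and>
       (a \<succsim>\<^sup>W\<^sup>N b \<and> b \<succsim>\<^sup>S\<^sup>N c \<longrightarrow> a \<succsim>\<^sup>W\<^sup>N c) \<and>
       (a \<succsim>\<^sup>W\<^sup>N b \<and> b \<succsim>\<^sup>S\<^sup>P c \<longrightarrow> a \<succsim>\<^sup>W\<^sup>P c) \<and>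
       (a \<succsim>\<^sup>S\<^sup>P b \<and> b \<Delta>\<^sup>S c \<longrightarrow> a \<succsim>\<^sup>S\<^sup>P c) \<and>
       (a \<succsim>\<^sup>S\<^sup>P b \<and> b \<Delta> c \<longrightarrow> a \<succsim>\<^sup>P c) \<and>
       (a \<succsim>\<^sup>S\<^sup>P b \<and> b \<Delta>\<^sup>W c \<longrightarrow> a \<succsim>\<^sup>W\<^sup>P c) \<and>
       (a \<succsim>\<^sup>S\<^sup>P b \<and> b \<succsim>\<^sup>S\<^sup>N c \<longrightarrow> a \<succsim>\<^sup>S\<^sup>P c) \<and>
       (a \<succsim>\<^sup>S\<^sup>P b \<and> b \<succsim>\<^sup>W\<^sup>N c \<longrightarrow> a \<succsim>\<^sup>W\<^sup>P c) \<and>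
       (a \<succsim>\<^sup>P b \<and> b \<Delta>\<^sup>S c \<longrightarrow> a \<succsim>\<^sup>P c) \<and>
       (a \<succsim>\<^sup>W\<^sup>P b \<and> b \<Delta>\<^sup>S c \<longrightarrow> a \<succsim>\<^sup>W\<^sup>P c) \<and>
       (a \<succsim>\<^sup>W\<^sup>P b \<and> b \<succsim>\<^sup>S\<^sup>N c \<longrightarrow> a \<succsim>\<^sup>W\<^sup>P c))"
proof -
  note P = assms(1)
  have ne: "\<U> \<noteq> {}" using assms(2) by blast
  show ?thesis
  proof ((rule conjI; intro ballI), goal_cases)
    case (1 a b)
    show ?case
      by (intro conjI hierarchy[OF P ne 1])
  next
    case (2 a b c)
    note facts = hierarchy[OF P ne 2(1,2)] hierarchy[OF P ne 2(2,3)] hierarchy[OF P ne 2(1,3)]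
      dom_compositions[OF P, of a b c] preference_compositions[OF P 2]
      necessary_or_possible_converse[of P a b]
    \<comment> \<open>A dominance hypothesis combined with a preference is replaced by the necessary preference
      that it implies, which leaves only propositional reasoning.\<close>
    show ?case
      by (intro conjI; use facts in argo)
  qed
qed

end
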